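(* Assume that $w=(w_1,\dots,w_m)$ is not constant in the element, i.e. not all of the vectors $w_1,\dots,w_m\in\mathbb{R}^n$ are scalar multiples of $\mathbf 1$. Then the optimization problem $$\min_{\mathfrak{r}\in(\mathbb{R}^n)^m}\ \frac12\|\mathfrak{r}\|_M^2\quad\text{subject to}\quad\mathbf 1^T M\mathfrak{r}_i=0\ \text{ for all } i\in\{1,\dots,m\},\qquad\sum_{i=1}^m w_i^T M\mathfrak{r}_i\le\mathcal{E},$$ where $\|\mathfrak{r}\|_M^2=\sum_{i=1}^m\mathfrak{r}_i^T M\mathfrak{r}_i$, has a unique solution $\mathfrak{r}=(\mathfrak{r}_1,\dots,\mathfrak{r}_m)$. It is given by $\mathfrak{r}=0$ if $\mathcal{E}>0$, and by $$\mathfrak{r}_i=\alpha\left(w_i-\frac{\mathbf 1^T M w_i}{\mathbf 1^T M\mathbf 1}\,\mathbf 1\right),\quad i\in\{1,\dots,m\},\qquad\alpha=\frac{\mathcal{E}}{\sum_{k=1}^m\left(w_k^T M w_k-\frac{(\mathbf 1^T M w_k)^2}{\mathbf 1^T M\mathbf 1}\right)}$$ if $\mathcal{E}\le 0$.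
   Context: Consider a semidiscretization of a system of $m$ conservation laws in $d$ space dimensions with a convex entropy $U$ and entropy variables $w=\partial_u U(u)$, on one element with $n$ nodes and $n_b$ boundary nodes, at a fixed time and for a given numerical state. $w_i\in\mathbb{R}^n$ is the vector of nodal values of the $i$-th component of the entropy variables and $\mathbf 1$ denotes the vector all of whose entries are $1$. $M\in\mathbb{R}^{n\times n}$ is the mass matrix, symmetric positive definite and diagonal; $R\in\mathbb{R}^{n_b\times n}$ is the restriction/interpolation to the boundary nodes; $B\in\mathbb{R}^{n_b\times n_b}$ is the symmetric positive definite boundary mass matrix; $N_j\in\mathbb{R}^{n_b\times n_b}$ represents multiplication of boundary values by the $j$-th component of the outer unit normal. $\mathrm{VOL}_i,\mathrm{SURF}_i\in\mathbb{R}^n$ are the volume and surface terms of a given baseline semidiscretization $\partial_t u_i=\mathrm{VOL}_i+\mathrm{SURF}_i$, and $F^{\mathrm{num},j}\in\mathbb{R}^{n_b}$ contains the values at the boundary nodes of the numerical entropy flux in direction $j$. The real number $\mathcal{E}$ is defined by $$\mathcal{E}=-\sum_{j=1}^d\mathbf 1^T R^T B N_j F^{\mathrm{num},j}-\sum_{k=1}^m w_k^T M\,\mathrm{VOL}_k-\sum_{k=1}^m w_k^T M\,\mathrm{SURF}_k.$$ *)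

theory Defs
  imports "HOL-Analysis.Analysis"
begin

text \<open>
  Index types: \<open>'n\<close> nodes, \<open>'b\<close> boundary nodes, \<open>'m\<close> conserved variables, \<open>'d\<close> space
  directions. A family of nodal vectors \<open>(w\<^sub>1, \<dots>, w\<^sub>m)\<close> is \<open>w :: real^'n^'m\<close> with
  \<open>w $ i :: real^'n\<close>, so that \<open>column p w :: real^'m\<close> collects the values of all components
  at node \<open>p\<close>. The constant \<open>1 :: real^'n\<close> is the vector with all entries equal to 1 and
  \<open>x\<^sup>T A y\<close> is written \<open>x \<bullet> (A *v y)\<close>.
\<close>

definition sym_pos_def :: "real^'n^'n \<Rightarrow> bool" where
  "sym_pos_def A \<longleftrightarrow> transpose A = A \<and> (\<forall>x. x \<noteq> 0 \<longrightarrow> x \<bullet> (A *v x) > 0)"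

definition diagonal_matrix :: "real^'n^'n \<Rightarrow> bool" where
  "diagonal_matrix A \<longleftrightarrow> (\<forall>p q. p \<noteq> q \<longrightarrow> A $ p $ q = 0)"

text \<open>
  \<open>U\<close> is a convex differentiable function on the open convex set \<open>S\<close> of admissible states
  (\<open>convex_on\<close> includes convexity of \<open>S\<close>).
\<close>

definition convex_entropy :: "(real^'m) set \<Rightarrow> (real^'m \<Rightarrow> real) \<Rightarrow> bool" where
  "convex_entropy S U \<longleftrightarrow> open S \<and> convex_on S U \<and> U differentiable_on S"

definition entropy_variables ::
    "(real^'m \<Rightarrow> real) \<Rightarrow> real^'n^'m \<Rightarrow> real^'n^'m \<Rightarrow> bool" where
  "entropy_variables U u w \<longleftrightarrow> (\<forall>p. GDERIV U (column p u) :> column p w)"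

definition entropy_rhs ::
    "real^'n^'n \<Rightarrow> real^'n^'b \<Rightarrow> real^'b^'b \<Rightarrow> real^'b^'b^'d \<Rightarrow> real^'b^'d
      \<Rightarrow> real^'n^'m \<Rightarrow> real^'n^'m \<Rightarrow> real^'n^'m \<Rightarrow> real" where
  "entropy_rhs M R B N Fnum VOL SURF w =
     - (\<Sum>j\<in>UNIV. 1 \<bullet> ((transpose R ** B ** N $ j) *v (Fnum $ j)))
     - (\<Sum>k\<in>UNIV. w $ k \<bullet> (M *v (VOL $ k)))
     - (\<Sum>k\<in>UNIV. w $ k \<bullet> (M *v (SURF $ k)))"

definition mass_norm_sq :: "real^'n^'n \<Rightarrow> real^'n^'m \<Rightarrow> real" where
  "mass_norm_sq M r = (\<Sum>i\<in>UNIV. r $ i \<bullet> (M *v (r $ i)))"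

definition feasible :: "real^'n^'n \<Rightarrow> real^'n^'m \<Rightarrow> real \<Rightarrow> real^'n^'m \<Rightarrow> bool" where
  "feasible M w E r \<longleftrightarrow>
     (\<forall>i. 1 \<bullet> (M *v (r $ i)) = 0) \<and> (\<Sum>i\<in>UNIV. w $ i \<bullet> (M *v (r $ i))) \<le> E"

definition solves_opt :: "real^'n^'n \<Rightarrow> real^'n^'m \<Rightarrow> real \<Rightarrow> real^'n^'m \<Rightarrow> bool" where
  "solves_opt M w E r \<longleftrightarrow> is_arg_min (\<lambda>r. 1/2 * mass_norm_sq M r) (feasible M w E) r"

definition alpha :: "real^'n^'n \<Rightarrow> real^'n^'m \<Rightarrow> real \<Rightarrow> real" where
  "alpha M w E =
     E / (\<Sum>k\<in>UNIV. w $ k \<bullet> (M *v (w $ k)) - (1 \<bullet> (M *v (w $ k)))\<^sup>2 / (1 \<bullet> (M *v 1)))"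

end

theory Submission
  imports Defs
begin

text \<open>
  A feasible \<open>r\<close> is the unique minimizer as soon as \<open>\<langle>r, s - r\<rangle> \<ge> 0\<close> for every feasible \<open>s\<close>, in the
  inner product induced by \<open>M\<close>. Subtracting the \<open>M\<close>-weighted mean from each component of \<open>w\<close> is the
  orthogonal projection \<open>v\<close> onto the conservative directions, so
  \<open>\<langle>v, s\<rangle> = \<langle>w, s\<rangle> \<le> \<E>\<close> for feasible \<open>s\<close>, and \<open>\<langle>v, v\<rangle>\<close> is the denominator of \<open>\<alpha>\<close>. If \<open>\<E> \<le> 0\<close>, then
  \<open>\<alpha> \<le> 0\<close> and \<open>\<langle>\<alpha> v, s\<rangle> \<ge> \<alpha> \<E> = \<langle>\<alpha> v, \<alpha> v\<rangle>\<close>.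
\<close>

definition mass_inner :: "real^'n^'n \<Rightarrow> real^'n^'m \<Rightarrow> real^'n^'m \<Rightarrow> real" where
  "mass_inner M r s = (\<Sum>i\<in>UNIV. r $ i \<bullet> (M *v (s $ i)))"

definition deviation :: "real^'n^'n \<Rightarrow> real^'n^'m \<Rightarrow> real^'n^'m" where
  "deviation M w = (\<chi> i. w $ i - ((1 \<bullet> (M *v (w $ i))) / (1 \<bullet> (M *v 1))) *\<^sub>R 1)"

lemma feasible_iff:
  "feasible M w E r \<longleftrightarrow> (\<forall>i. 1 \<bullet> (M *v (r $ i)) = 0) \<and> mass_inner M w r \<le> E"
  by (simp add: feasible_def mass_inner_def)

lemma mass_norm_sq_eq: "mass_norm_sq M r = mass_inner M r r"
  by (simp add: mass_norm_sq_def mass_inner_def)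

lemma mass_inner_add_left: "mass_inner M (r + s) t = mass_inner M r t + mass_inner M s t"
  by (simp add: mass_inner_def inner_add_left sum.distrib)

lemma mass_inner_add_right: "mass_inner M r (s + t) = mass_inner M r s + mass_inner M r t"
  by (simp add: mass_inner_def inner_add_right matrix_vector_right_distrib sum.distrib)

lemma mass_inner_diff_right: "mass_inner M r (s - t) = mass_inner M r s - mass_inner M r t"
  by (simp add: mass_inner_def inner_diff_right matrix_vector_mult_diff_distrib sum_subtractf)

lemma mass_inner_scaleR_left: "mass_inner M (a *\<^sub>R r) s = a * mass_inner M r s"
  by (simp add: mass_inner_def sum_distrib_left)

lemma mass_inner_scaleR_right: "mass_inner M r (a *\<^sub>R s) = a * mass_inner M r s"
  by (simp add: mass_inner_def sum_distrib_left matrix_vector_mult_scaleR)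

lemma sym_pos_def_inner_commute:
  assumes "sym_pos_def A"
  shows "x \<bullet> (A *v y) = y \<bullet> (A *v x)"
  using assms unfolding sym_pos_def_def
  by (metis dot_lmul_matrix inner_commute transpose_matrix_vector)

lemma mass_inner_commute:
  assumes "sym_pos_def M"
  shows "mass_inner M r s = mass_inner M s r"
  by (simp add: mass_inner_def sym_pos_def_inner_commute[OF assms])

lemma sym_pos_def_inner_nonneg:
  assumes "sym_pos_def A"
  shows "x \<bullet> (A *v x) \<ge> 0"
  using assms by (cases "x = 0") (auto simp: sym_pos_def_def less_imp_le)

lemma mass_inner_nonneg:
  assumes "sym_pos_def M"
  shows "mass_inner M r r \<ge> 0"
  unfolding mass_inner_def by (intro sum_nonneg sym_pos_def_inner_nonneg assms)

lemma mass_inner_eq_0_iff: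
  assumes "sym_pos_def M"
  shows "mass_inner M r r = 0 \<longleftrightarrow> r = 0"
proof
  assume "mass_inner M r r = 0"
  then have "r $ i \<bullet> (M *v (r $ i)) = 0" for i
    using sym_pos_def_inner_nonneg[OF assms]
    by (simp add: mass_inner_def sum_nonneg_eq_0_iff)
  then have "r $ i = 0" for i
    using assms unfolding sym_pos_def_def by (metis less_irrefl)
  then show "r = 0"
    by (simp add: vec_eq_iff)
qed (simp add: mass_inner_def)

text \<open>Expanding the squared norm of \<open>t = r + (t - r)\<close> leaves a cross term that
  \<open>var\<close> makes nonnegative. The surplus \<open>mass_norm_sq M (t - r)\<close> in
  \<open>le\<close> gives uniqueness together with minimality.\<close>

lemma solves_opt_iff_variational:
  assumes M: "sym_pos_def M" and r: "feasible M w E r"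
    and var: "\<And>s. feasible M w E s \<Longrightarrow> mass_inner M r (s - r) \<ge> 0"
  shows "solves_opt M w E s \<longleftrightarrow> s = r"
proof -
  have le: "mass_norm_sq M r + mass_norm_sq M (t - r) \<le> mass_norm_sq M t"
    if "feasible M w E t" for t
  proof -
    have "mass_norm_sq M (r + (t - r))
        = mass_norm_sq M r + 2 * mass_inner M r (t - r) + mass_norm_sq M (t - r)"
      using mass_inner_commute[OF M, of r "t - r"]
      unfolding mass_norm_sq_eq mass_inner_add_left mass_inner_add_right by simp
    with var[OF that] show ?thesis by simp
  qed
  have nonneg: "mass_norm_sq M t \<ge> 0" for t
    by (simp add: mass_norm_sq_eq mass_inner_nonneg[OF M])
  show ?thesis
  proof
    assume "solves_opt M w E s"
    then have "feasible M w E s" "mass_norm_sq M s \<le> mass_norm_sq M r"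
      using r by (auto simp: solves_opt_def is_arg_min_linorder)
    \<comment> \<open>Since \<open>s\<close> is no longer than \<open>r\<close>, the surplus has no
      room to be positive.\<close>
    with le[of s] nonneg[of "s - r"] have "mass_norm_sq M (s - r) = 0"
      by simp
    then show "s = r"
      by (simp add: mass_norm_sq_eq mass_inner_eq_0_iff[OF M])
  next
    assume "s = r"
    moreover have "mass_norm_sq M r \<le> mass_norm_sq M t" if "feasible M w E t" for t
      using le[OF that] nonneg[of "t - r"] by simp
    ultimately show "solves_opt M w E s"
      using r by (simp add: solves_opt_def is_arg_min_linorder)
  qed
qed

lemma sym_pos_def_one:
  assumes "sym_pos_def A"
  shows "1 \<bullet> (A *v 1) > 0"
  using assms by (simp add: sym_pos_def_def)

lemma one_inner_deviation:
  assumes "sym_pos_def M"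
  shows "1 \<bullet> (M *v (deviation M w $ i)) = 0"
  using sym_pos_def_one[OF assms]
  by (simp add: deviation_def matrix_vector_mult_diff_distrib matrix_vector_mult_scaleR
      inner_diff_right)

text \<open>The part removed from \<open>w\<close> consists of multiples of 1, which are orthogonal
  to every conservative \<open>s\<close>.\<close>

lemma mass_inner_deviation_left:
  assumes "\<And>i. 1 \<bullet> (M *v (s $ i)) = 0"
  shows "mass_inner M (deviation M w) s = mass_inner M w s"
  by (simp add: mass_inner_def deviation_def inner_diff_left assms)

lemma alpha_eq:
  assumes "sym_pos_def M"
  shows "alpha M w E = E / mass_inner M (deviation M w) (deviation M w)"
proof -
  \<comment> \<open>As the deviation is itself conservative, one of the two factors may be replaced
    by \<open>w\<close>, so no full square has to be expanded.\<close>
  have "mass_inner M (deviation M w) (deviation M w) = mass_inner M w (deviation M w)"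
    by (rule mass_inner_deviation_left) (rule one_inner_deviation[OF assms])
  also have "\<dots> = (\<Sum>k\<in>UNIV. w $ k \<bullet> (M *v (w $ k)) - (1 \<bullet> (M *v (w $ k)))\<^sup>2 / (1 \<bullet> (M *v 1)))"
    by (simp add: mass_inner_def deviation_def matrix_vector_mult_diff_distrib
        matrix_vector_mult_scaleR inner_diff_right power2_eq_square
        sym_pos_def_inner_commute[OF assms, of "w $ k" 1 for k])
  finally show ?thesis
    by (simp add: alpha_def)
qed

text \<open>The constant is the weighted mean of \<open>w $ i\<close>. By contraposition, a
  nonconstant \<open>w\<close> has nonzero deviation.\<close>

lemma deviation_eq_0_imp_constant:
  assumes "deviation M w = 0"
  shows "\<exists>c. w $ i = c *\<^sub>R 1"
proof -
  have "deviation M w $ i = 0"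
    using assms by simp
  then show ?thesis
    by (auto simp: deviation_def)
qed

text \<open>Zero is feasible here, and pairing it with any \<open>s - 0\<close> gives 0.\<close>

lemma solves_opt_pos_iff:
  assumes "sym_pos_def M" "E > 0"
  shows "solves_opt M w E r \<longleftrightarrow> r = 0"
  using assms
  by (intro solves_opt_iff_variational) (simp_all add: feasible_iff mass_inner_def)

lemma solves_opt_nonpos_iff:
  assumes M: "sym_pos_def M" and "deviation M w \<noteq> 0" and "E \<le> 0"
  shows "solves_opt M w E r \<longleftrightarrow> r = alpha M w E *\<^sub>R deviation M w"
proof (rule solves_opt_iff_variational[OF M])
  let ?v = "deviation M w" and ?a = "alpha M w E"
  \<comment> \<open>Positivity makes the division in \<alpha> genuine and lets \<alpha> inherit the
    sign of \<open>E\<close>.\<close>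
  have pos: "mass_inner M ?v ?v > 0"
    using assms mass_inner_nonneg[OF M] mass_inner_eq_0_iff[OF M] by (metis less_le)
  then have a: "?a \<le> 0" and aE: "?a * mass_inner M ?v ?v = E"
    using \<open>E \<le> 0\<close> by (simp_all add: alpha_eq[OF M] divide_nonpos_pos)
  have wv: "mass_inner M w ?v = mass_inner M ?v ?v"
    by (rule mass_inner_deviation_left[symmetric]) (rule one_inner_deviation[OF M])
  \<comment> \<open>The entropy constraint holds with equality: \<alpha> is the scaling of
    \<open>?v\<close> for which its left side is exactly \<open>E\<close>.\<close>
  show "feasible M w E (?a *\<^sub>R ?v)"
    using aE by (simp add: feasible_iff mass_inner_scaleR_right wv matrix_vector_mult_scaleR
        one_inner_deviation[OF M])
  fix s assume "feasible M w E s"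
  then have "mass_inner M ?v s \<le> E"
    by (simp add: feasible_iff mass_inner_deviation_left)
  then have "mass_inner M ?v (s - ?a *\<^sub>R ?v) \<le> 0"
    by (simp add: mass_inner_diff_right mass_inner_scaleR_right aE)
  \<comment> \<open>Both factors, \<alpha> and the pairing with \<open>?v\<close>, are
    nonpositive.\<close>
  with a show "mass_inner M (?a *\<^sub>R ?v) (s - ?a *\<^sub>R ?v) \<ge> 0"
    by (simp add: mass_inner_scaleR_left mult_nonpos_nonpos)
qed

theorem theorem3p1:
  fixes S :: "(real^'m) set" and U :: "real^'m \<Rightarrow> real"
    and u w VOL SURF :: "real^'n^'m"
    and M :: "real^'n^'n" and R :: "real^'n^'b" and B :: "real^'b^'b"
    and N :: "real^'b^'b^'d" and Fnum :: "real^'b^'d"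
    and E :: real
  assumes "convex_entropy S U"
    and "\<forall>p. column p u \<in> S"
    and "entropy_variables U u w"
    and "sym_pos_def M" and "diagonal_matrix M"
    and "sym_pos_def B"
    and "E = entropy_rhs M R B N Fnum VOL SURF w"
    and nonconstant: "\<not> (\<forall>i. \<exists>c. w $ i = c *\<^sub>R 1)"
  shows "(\<exists>!r. solves_opt M w E r) \<and>
    (\<forall>r. solves_opt M w E r \<longrightarrow>
      (E > 0 \<longrightarrow> r = 0) \<and>
      (E \<le> 0 \<longrightarrow>
        (\<forall>i. r $ i =
          alpha M w E *\<^sub>R (w $ i - ((1 \<bullet> (M *v (w $ i))) / (1 \<bullet> (M *v 1))) *\<^sub>R 1))))"
proof (cases "E > 0")
  case True
  then show ?thesis
    by (simp add: solves_opt_pos_iff[OF \<open>sym_pos_def M\<close>])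
next
  case False
  have "deviation M w \<noteq> 0"
    using nonconstant deviation_eq_0_imp_constant by blast
  with False show ?thesis
    by (simp add: solves_opt_nonpos_iff[OF \<open>sym_pos_def M\<close>]) (simp add: deviation_def)
qed

end
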